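(* A general binary sextic $p \in H_6(\mathbb{C}^2)$ can be written as $p(x,y) = f^2(x,y) + g^3(x,y)$, where $f \in H_3(\mathbb{C}^2)$ is a cubic form and $g \in H_2(\mathbb{C}^2)$ is a quadratic form.
   Context: $H_d(\mathbb{C}^n)$ denotes the complex vector space of homogeneous polynomials of degree $d$ in $n$ variables. "A general $p$ has property P" means P holds for all $p$ in a nonempty Zariski-open subset of $H_d(\mathbb{C}^n)$. *)

theory Defs
  imports Complex_Main
begin

text \<open>A homogeneous polynomial of degree d in two variables (binary form) is represented
by its coefficient vector c :: nat \<Rightarrow> complex, where c i is the coefficient of
x^i y^(d-i), and c i = 0 for i > d. Thus H_d(C^2) is identified with C^(d+1).\<close>

definition hom_forms :: "nat \<Rightarrow> (nat \<Rightarrow> complex) set" where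
  "hom_forms d = {c. \<forall>i>d. c i = 0}"

definition bform :: "nat \<Rightarrow> (nat \<Rightarrow> complex) \<Rightarrow> complex \<Rightarrow> complex \<Rightarrow> complex" where
  "bform d c x y = (\<Sum>i\<le>d. c i * x ^ i * y ^ (d - i))"

inductive_set polyfun :: "nat \<Rightarrow> ((nat \<Rightarrow> complex) \<Rightarrow> complex) set" for n :: nat where
  const: "(\<lambda>_. a) \<in> polyfun n"
| var: "i < n \<Longrightarrow> (\<lambda>c. c i) \<in> polyfun n"
| add: "p \<in> polyfun n \<Longrightarrow> q \<in> polyfun n \<Longrightarrow> (\<lambda>c. p c + q c) \<in> polyfun n"
| mult: "p \<in> polyfun n \<Longrightarrow> q \<in> polyfun n \<Longrightarrow> (\<lambda>c. p c * q c) \<in> polyfun n"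

definition zariski_open_in :: "nat \<Rightarrow> (nat \<Rightarrow> complex) set \<Rightarrow> bool" where
  "zariski_open_in d U \<longleftrightarrow>
     (\<exists>S \<subseteq> polyfun (Suc d). U = hom_forms d - {c. \<forall>q\<in>S. q c = 0})"

definition general :: "nat \<Rightarrow> ((nat \<Rightarrow> complex) \<Rightarrow> bool) \<Rightarrow> bool" where
  "general d P \<longleftrightarrow> (\<exists>U. zariski_open_in d U \<and> U \<noteq> {} \<and> (\<forall>p\<in>U. P p))"

end

theory Submission
  imports Defs "HOL-Analysis.Analysis" "HOL-Computational_Algebra.Fundamental_Theorem_Algebra"
    "Jordan_Normal_Form.Determinant"
begin

text \<open>
  Every sextic \<open>P\<close> with simple roots is of the form \<open>f\<^sup>2 + g\<^sup>3\<close>, because over the set of such sextics the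
  map \<open>(f, g) \<mapsto> f\<^sup>2 + g\<^sup>3\<close> is a proper local diffeomorphism, so that its image is open and closed there.
  Its differential \<open>2 f a + 3 g\<^sup>2 b\<close> is injective since \<open>f\<close> and \<open>g\<close> are coprime, whence \<open>g\<^sup>2\<close> divides
  \<open>a\<close> and degrees force \<open>a = 0\<close>. For properness, suppose that \<open>f\<^sub>n\<^sup>2 + g\<^sub>n\<^sup>3\<close> converges to \<open>P\<close> while
  \<open>(f\<^sub>n, g\<^sub>n)\<close> is unbounded. Rescaling with weights \<open>(3, 2)\<close> gives a nonzero limit with
  \<open>f\<^sup>2 + g\<^sup>3 = 0\<close>, so \<open>f\<close> and \<open>g\<close> are multiples of \<open>l\<^sup>3\<close> and \<open>l\<^sup>2\<close> for a linear form \<open>l\<close>; the identity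
  \<open>P' g - 3 P g' = f (2 f' g - 3 f g')\<close> survives in the limit as a divisibility by \<open>f\<close> and makes \<open>l\<close>
  a double factor of \<open>P\<close>. Finally, on the complex line joining \<open>P\<close> to \<open>x\<^sup>6 + y\<^sup>6 = (x\<^sup>3)\<^sup>2 + (y\<^sup>2)\<^sup>3\<close> the
  sextics with simple roots form the complement of a finite set, which is connected.
\<close>

section \<open>Divisibility and double roots of complex polynomials\<close>

text \<open>Induction on \<open>degree g\<close>: a root of \<open>g\<close> is a root of
  \<open>f * a\<close> but not of \<open>f\<close>, so its linear factor can be cancelled from both
  \<open>g\<close> and \<open>a\<close>.\<close>

lemma dvd_mult_no_common_root:
  fixes f g a :: "complex poly"
  assumes "g \<noteq> 0" and "\<And>z. poly f z = 0 \<Longrightarrow> poly g z \<noteq> 0" and "g dvd f * a"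
  shows "g dvd a"
  using assms
proof (induction "degree g" arbitrary: g a)
  case 0
  then show ?case by (metis is_unit_iff_degree unit_imp_dvd)
next
  case (Suc n)
  obtain r where r: "poly g r = 0"
    using fundamental_theorem_of_algebra[of g] Suc.hyps(2) by (auto simp: constant_degree)
  then obtain g1 where g1: "g = [:- r, 1:] * g1" by (auto simp: poly_eq_0_iff_dvd dvd_def)
  obtain k where "f * a = g * k" using Suc.prems(3) by (rule dvdE)
  then have "poly (f * a) r = 0" using r by simp
  then have "poly a r = 0" using Suc.prems(2)[of r] r by auto
  then obtain a1 where a1: "a = [:- r, 1:] * a1" by (auto simp: poly_eq_0_iff_dvd dvd_def)
  have "[:- r, 1:] * g1 dvd [:- r, 1:] * (f * a1)"
    using Suc.prems(3) unfolding g1 a1 by (simp only: ac_simps)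
  then have "g1 dvd f * a1" by (subst (asm) dvd_mult_cancel_left) simp
  moreover have "g1 \<noteq> 0" using Suc.prems(1) g1 by auto
  moreover have "n = degree g1"
    using Suc.hyps(2) \<open>g1 \<noteq> 0\<close> unfolding g1 by (subst (asm) degree_mult_eq) auto
  moreover have "poly g1 z \<noteq> 0" if "poly f z = 0" for z
    using Suc.prems(2)[OF that] by (auto simp: g1)
  ultimately have "g1 dvd a1" using Suc.hyps(1) by blast
  then show ?case unfolding g1 a1 by (rule mult_dvd_mono[OF dvd_refl])
qed

text \<open>A common root of \<open>f\<close> and \<open>g\<close> would be a double root of
  \<open>P\<close>. Hence \<open>a = g\<^sup>2 * h\<close> and \<open>3 * b = - (2 * f * h)\<close>;
  a nonzero \<open>h\<close> would force \<open>degree g \<le> 1\<close> and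
  \<open>degree f \<le> 2\<close>, too small for \<open>degree P = 6\<close>.\<close>

lemma sq_plus_cube_tangent_injective:
  fixes f g a b :: "complex poly"
  assumes deg: "degree f \<le> 3" "degree g \<le> 2" "degree a \<le> 3" "degree b \<le> 2"
    and P: "P = f\<^sup>2 + g ^ 3" "degree P = 6"
    and simple: "\<And>z. poly P z = 0 \<Longrightarrow> poly (pderiv P) z \<noteq> 0"
    and eq: "2 * f * a + 3 * g\<^sup>2 * b = 0"
  shows "a = 0 \<and> b = 0"
proof -
  have ncr: "poly g z \<noteq> 0" if "poly f z = 0" for z
    using that simple[of z] by (auto simp: P(1) pderiv_add pderiv_mult eval_nat_numeral)
  have "g \<noteq> 0"
  proof
    assume "g = 0"
    \<comment> \<open>Now every root of \<open>f\<close> would be a common root, so \<open>f\<close>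
      has none.\<close>
    then have "constant (poly f)" using ncr fundamental_theorem_of_algebra[of f] by auto
    then have "degree f = 0" by (simp add: constant_degree)
    then show False using P \<open>g = 0\<close> degree_power_le[of f 2] by simp
  qed
  have "2 * (f * a) = g\<^sup>2 * (- 3 * b)" using eq by (simp add: algebra_simps eq_neg_iff_add_eq_0)
  then have "g\<^sup>2 dvd 2 * (f * a)" by (metis dvd_triv_left)
  moreover have "is_unit (2 :: complex poly)" by (simp add: is_unit_iff_degree)
  ultimately have "g\<^sup>2 dvd f * a" by (simp add: dvd_mult_unit_iff')
  then have "g\<^sup>2 dvd a" by (rule dvd_mult_no_common_root[rotated 2]) (use \<open>g \<noteq> 0\<close> ncr in auto)
  then obtain h where h: "a = g\<^sup>2 * h" by (elim dvdE)
  have "g\<^sup>2 * (2 * f * h + 3 * b) = 0" using eq by (simp add: h algebra_simps)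
  then have b: "3 * b = - (2 * f * h)" using \<open>g \<noteq> 0\<close> by (simp add: eq_neg_iff_add_eq_0 add.commute)
  have "h = 0"
  proof (rule ccontr)
    assume "h \<noteq> 0"
    have "2 * degree g + degree h \<le> 3"
      using deg(3) \<open>h \<noteq> 0\<close> \<open>g \<noteq> 0\<close> by (simp add: h degree_mult_eq degree_power_eq)
    then have dg: "degree g \<le> 1" by simp
    have df: "degree f \<le> 2"
    proof (cases "f = 0")
      case False
      have "degree (3 * b) \<le> 2" using deg(4) degree_mult_le[of 3 b] by simp
      moreover have "degree (2 * f * h) = degree f + degree h"
        using False \<open>h \<noteq> 0\<close> by (simp add: degree_mult_eq)
      ultimately show ?thesis using b by simp
    qed simp
    have "degree (f\<^sup>2) \<le> 4" using degree_power_le[of f 2] df by simp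
    moreover have "degree (g ^ 3) \<le> 4" using degree_power_le[of g 3] dg by simp
    ultimately have "degree P \<le> 4" unfolding P(1) by (rule degree_add_le)
    then show False using P(2) by simp
  qed
  then show ?thesis using b h by simp
qed

text \<open>As forms, \<open>f\<close> and \<open>g\<close> are multiples of the cube and the square
  of one linear form. If its root is finite, evaluating \<open>eq\<close> there after cancelling
  powers of the linear factor shows, in two rounds, that this factor divides \<open>P\<close>
  twice.\<close>

lemma degenerate_limit_double_root:
  fixes f g k P :: "complex poly"
  assumes deg: "degree f \<le> 3" "degree g \<le> 2" "degree k \<le> 4" "degree P = 6"
    and rel: "f\<^sup>2 + g ^ 3 = 0" and nz: "f \<noteq> 0 \<or> g \<noteq> 0"
    and eq: "f * k = pderiv P * g - 3 * P * pderiv g"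
  shows "\<exists>z. poly P z = 0 \<and> poly (pderiv P) z = 0"
proof -
  have fg: "f\<^sup>2 = - (g ^ 3)" using rel by (simp add: eq_neg_iff_add_eq_0)
  have f0: "f \<noteq> 0" and g0: "g \<noteq> 0" using fg nz by auto
  have dd: "2 * degree f = 3 * degree g"
    using arg_cong[OF fg, of degree] f0 g0 by (simp add: degree_power_eq)
  show ?thesis
  proof (cases "degree g = 0")
    case True
    then obtain c where c: "g = [:c:]" by (rule degree_eq_zeroE)
    with g0 have "c \<noteq> 0" by simp
    \<comment> \<open>The linear form is \<open>y\<close>, with its root at infinity, where
      \<open>P\<close> does not vanish: the right side has degree 5, the left at most 4.\<close>
    have "f * k = Polynomial.smult c (pderiv P)" using eq by (simp add: c pderiv_pCons)
    then have "degree (f * k) = 5" using \<open>c \<noteq> 0\<close> deg(4) by (simp add: degree_pderiv)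
    moreover have "degree (f * k) \<le> 4" using degree_mult_le[of f k] deg(3) dd True by simp
    ultimately show ?thesis by simp
  next
    case False
    then obtain r where r: "poly g r = 0"
      using fundamental_theorem_of_algebra[of g] by (auto simp: constant_degree)
    have "order r (f\<^sup>2) = order r (g ^ 3)" by (simp add: fg)
    then have oo: "2 * order r f = 3 * order r g"
      using f0 g0 by (simp add: order_power_n_n order_mult power2_eq_square power3_eq_cube)
    have "order r g \<noteq> 0" using r g0 by (simp add: order_root)
    moreover have "order r g \<le> 2" using order_degree[OF g0, of r] deg(2) by simp
    ultimately have og: "order r g = 2" and of: "order r f = 3" using oo by presburger+
    define L where "L = [:- r, 1:]"
    have L0: "L \<noteq> 0" and Lr: "poly L r = 0" and L': "pderiv L = 1" by (simp_all add: L_def pderiv_pCons)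
    obtain g1 where g1: "g = L\<^sup>2 * g1" and "\<not> L dvd g1"
      using order_decomp[OF g0, of r] og by (auto simp: L_def)
    then have g1r: "poly g1 r \<noteq> 0" by (simp add: L_def poly_eq_0_iff_dvd)
    obtain f1 where f1: "f = L ^ 3 * f1"
      using order_decomp[OF f0, of r] of by (auto simp: L_def)
    have "L * (L\<^sup>2 * f1 * k) = L * (L * pderiv P * g1 - 6 * P * g1 - 3 * P * L * pderiv g1)"
      using eq by (simp add: f1 g1 pderiv_mult power2_eq_square power3_eq_cube L' algebra_simps)
    then have e1: "L\<^sup>2 * f1 * k = L * pderiv P * g1 - 6 * P * g1 - 3 * P * L * pderiv g1"
      using L0 by simp
    have "poly P r = 0"
      using arg_cong[OF e1, of "\<lambda>q. poly q r"] g1r Lr by simp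
    then obtain s where s: "P = L * s" by (auto simp: poly_eq_0_iff_dvd L_def elim: dvdE)
    \<comment> \<open>The product rule for \<open>P = L * s\<close> adds one \<open>s * g1\<close>,
      turning the coefficient -6 into -5, which is still nonzero.\<close>
    have "L * (L * f1 * k) = L * (L * pderiv s * g1 - 5 * s * g1 - 3 * s * L * pderiv g1)"
      using e1 by (simp add: s pderiv_mult power2_eq_square L' algebra_simps)
    then have e2: "L * f1 * k = L * pderiv s * g1 - 5 * s * g1 - 3 * s * L * pderiv g1"
      using L0 by simp
    have "poly s r = 0"
      using arg_cong[OF e2, of "\<lambda>q. poly q r"] g1r Lr by simp
    then show ?thesis using Lr by (intro exI[of _ r]) (simp add: s pderiv_mult L')
  qed
qed

section \<open>Passing a divisibility to the limit\<close>

text \<open>The factors \<open>kn\<close> are not assumed to converge. Injectivity bounds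
  \<open>m a\<close> from below, which makes \<open>kn\<close> eventually bounded; replacing
  \<open>an\<close> by \<open>a\<close> then costs a null sequence, and the range of
  \<open>m a\<close> is a closed subspace.\<close>

lemma bilinear_limit_in_range:
  fixes m :: "'a::euclidean_space \<Rightarrow> 'b::euclidean_space \<Rightarrow> 'c::euclidean_space"
  assumes m: "bounded_bilinear m" and inj: "\<And>k. m a k = 0 \<Longrightarrow> k = 0"
    and an: "an \<longlonglongrightarrow> a" and lim: "(\<lambda>n. m (an n) (kn n)) \<longlonglongrightarrow> h"
  shows "\<exists>k. m a k = h"
proof -
  interpret bounded_bilinear m by fact
  have lin: "linear (m a)" by (rule bounded_linear.linear[OF bounded_linear_right])
  then obtain B where B: "B > 0" "\<And>k. B * norm k \<le> norm (m a k)"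
    using linear_inj_bounded_below_pos[of "m a"] inj by (auto simp: linear_injective_0)
  obtain C where C: "C > 0" "\<And>x y. norm (m x y) \<le> norm x * norm y * C"
    using pos_bounded by blast
  have "(\<lambda>n. norm (an n - a)) \<longlonglongrightarrow> 0" using an by (simp add: LIM_zero tendsto_norm_zero)
  \<comment> \<open>With this threshold the error term uses up at most half of the lower bound
    \<open>B\<close>.\<close>
  then have ev: "\<forall>\<^sub>F n in sequentially. norm (an n - a) < B / (2 * C)"
    using B(1) C(1) by (intro order_tendstoD) auto
  have bd: "norm (kn n) \<le> norm (m (an n) (kn n)) * (2 / B)" if "norm (an n - a) < B / (2 * C)" for n
  proof -
    have "B * norm (kn n) \<le> norm (m a (kn n))" by (rule B)
    also have "m a (kn n) = m (an n) (kn n) - m (an n - a) (kn n)" by (simp add: diff_left)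
    also have "norm \<dots> \<le> norm (m (an n) (kn n)) + norm (m (an n - a) (kn n))" by (rule norm_triangle_ineq4)
    also have "norm (m (an n - a) (kn n)) \<le> norm (an n - a) * norm (kn n) * C" by (rule C)
    also have "\<dots> \<le> B / (2 * C) * norm (kn n) * C"
      using that C(1) by (intro mult_right_mono) auto
    also have "\<dots> = B / 2 * norm (kn n)" using C(1) by simp
    finally show ?thesis using B(1) by (simp add: field_simps)
  qed
  have "Bfun kn sequentially"
  proof -
    obtain M where M: "\<forall>n. norm (m (an n) (kn n)) \<le> M"
      using convergent_imp_Bseq[OF convergentI[OF lim]] by (rule BseqE)
    show ?thesis
    proof (rule BfunI)
      show "\<forall>\<^sub>F n in sequentially. norm (kn n) \<le> M * (2 / B)"
        using ev
      proof eventually_elim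
        case (elim n)
        have "norm (m (an n) (kn n)) * (2 / B) \<le> M * (2 / B)"
          using M B(1) by (intro mult_right_mono) auto
        with bd[OF elim] show ?case by simp
      qed
    qed
  qed
  moreover have "Zfun (\<lambda>n. an n - a) sequentially" using an by (simp add: tendsto_Zfun_iff)
  ultimately have "Zfun (\<lambda>n. m (an n - a) (kn n)) sequentially"
    by (rule Zfun_prod_Bfun[rotated])
  then have "(\<lambda>n. m (an n - a) (kn n)) \<longlonglongrightarrow> 0" by (simp add: tendsto_Zfun_iff)
  from tendsto_diff[OF lim this] have *: "(\<lambda>n. m a (kn n)) \<longlonglongrightarrow> h" by (simp add: diff_left)
  have "closed (range (m a))"
    by (rule closed_subspace) (simp add: lin linear_subspace_image)
  then have "h \<in> range (m a)"
    by (rule closed_sequentially[OF _ _ *]) simp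
  then show ?thesis by auto
qed

section \<open>Coefficient tuples and the map from (f, g) to f^2 + g^3\<close>

text \<open>Nested pairs, constant coefficient first, are Euclidean spaces with the degree bounds
  built in, as limits and derivatives require; \<open>poly3\<close> to \<open>poly8\<close> lead
  back to polynomials for arguments about roots.\<close>

type_synonym c3 = "complex \<times> complex \<times> complex"
type_synonym c4 = "complex \<times> c3"
type_synonym c5 = "complex \<times> c4"
type_synonym c7 = "complex \<times> complex \<times> c5"
type_synonym c8 = "complex \<times> c7"

fun poly3 :: "c3 \<Rightarrow> complex poly" where "poly3 (a, b, c) = [:a, b, c:]"
fun poly4 :: "c4 \<Rightarrow> complex poly" where "poly4 (a, v) = pCons a (poly3 v)"
fun poly5 :: "c5 \<Rightarrow> complex poly" where "poly5 (a, v) = pCons a (poly4 v)"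
fun poly7 :: "c7 \<Rightarrow> complex poly" where "poly7 (a, b, v) = pCons a (pCons b (poly5 v))"
fun poly8 :: "c8 \<Rightarrow> complex poly" where "poly8 (a, v) = pCons a (poly7 v)"

fun sq_cube :: "c4 \<times> c3 \<Rightarrow> c7" where
  "sq_cube ((f0, f1, f2, f3), (g0, g1, g2)) =
    (f0\<^sup>2 + g0 ^ 3,
     2 * f0 * f1 + 3 * g0\<^sup>2 * g1,
     f1\<^sup>2 + 2 * f0 * f2 + 3 * g0\<^sup>2 * g2 + 3 * g0 * g1\<^sup>2,
     2 * f0 * f3 + 2 * f1 * f2 + g1 ^ 3 + 6 * g0 * g1 * g2,
     f2\<^sup>2 + 2 * f1 * f3 + 3 * g0 * g2\<^sup>2 + 3 * g1\<^sup>2 * g2,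
     2 * f2 * f3 + 3 * g1 * g2\<^sup>2,
     f3\<^sup>2 + g2 ^ 3)"

text \<open>The coefficients of 2 F A + 3 G^2 B.\<close>

fun sq_cube_deriv :: "c4 \<times> c3 \<Rightarrow> c4 \<times> c3 \<Rightarrow> c7" where
  "sq_cube_deriv ((f0, f1, f2, f3), (g0, g1, g2)) ((a0, a1, a2, a3), (b0, b1, b2)) =
    (2 * f0 * a0 + 3 * g0\<^sup>2 * b0,
     2 * (f0 * a1 + f1 * a0) + 3 * (g0\<^sup>2 * b1 + 2 * g0 * g1 * b0),
     2 * (f0 * a2 + f1 * a1 + f2 * a0)
       + 3 * (g0\<^sup>2 * b2 + 2 * g0 * g1 * b1 + (g1\<^sup>2 + 2 * g0 * g2) * b0),
     2 * (f0 * a3 + f1 * a2 + f2 * a1 + f3 * a0)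
       + 3 * (2 * g0 * g1 * b2 + (g1\<^sup>2 + 2 * g0 * g2) * b1 + 2 * g1 * g2 * b0),
     2 * (f1 * a3 + f2 * a2 + f3 * a1)
       + 3 * ((g1\<^sup>2 + 2 * g0 * g2) * b2 + 2 * g1 * g2 * b1 + g2\<^sup>2 * b0),
     2 * (f2 * a3 + f3 * a2) + 3 * (2 * g1 * g2 * b2 + g2\<^sup>2 * b1),
     2 * f3 * a3 + 3 * g2\<^sup>2 * b2)"

fun mult45 :: "c4 \<Rightarrow> c5 \<Rightarrow> c8" where
  "mult45 (f0, f1, f2, f3) (k0, k1, k2, k3, k4) =
    (f0 * k0,
     f0 * k1 + f1 * k0,
     f0 * k2 + f1 * k1 + f2 * k0,
     f0 * k3 + f1 * k2 + f2 * k1 + f3 * k0,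
     f0 * k4 + f1 * k3 + f2 * k2 + f3 * k1,
     f1 * k4 + f2 * k3 + f3 * k2,
     f2 * k4 + f3 * k3,
     f3 * k4)"

text \<open>The coefficients of \<open>P' G - 3 P G'\<close>.\<close>

fun wronskian :: "c7 \<Rightarrow> c3 \<Rightarrow> c8" where
  "wronskian (p0, p1, p2, p3, p4, p5, p6) (g0, g1, g2) =
    (p1 * g0 - 3 * p0 * g1,
     2 * p2 * g0 - 2 * p1 * g1 - 6 * p0 * g2,
     3 * p3 * g0 - p2 * g1 - 5 * p1 * g2,
     4 * p4 * g0 - 4 * p2 * g2,
     5 * p5 * g0 + p4 * g1 - 3 * p3 * g2,
     6 * p6 * g0 + 2 * p5 * g1 - 2 * p4 * g2,
     3 * p6 * g1 - p5 * g2,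
     0)"

text \<open>The coefficients of \<open>2 F' G - 3 F G'\<close>, the cofactor of \<open>F\<close> in \<open>P' G - 3 P G'\<close> for \<open>P = F\<^sup>2 + G\<^sup>3\<close>;
  that of degree 4 cancels.\<close>

fun cofactor :: "c4 \<Rightarrow> c3 \<Rightarrow> c5" where
  "cofactor (f0, f1, f2, f3) (g0, g1, g2) =
    (2 * f1 * g0 - 3 * f0 * g1,
     4 * f2 * g0 - f1 * g1 - 6 * f0 * g2,
     6 * f3 * g0 + f2 * g1 - 4 * f1 * g2,
     3 * f3 * g1 - 2 * f2 * g2,
     0)"

lemma poly3_eq_0_iff [simp]: "poly3 g = 0 \<longleftrightarrow> g = 0"
  by (cases g) (simp add: zero_prod_def)

lemma poly4_eq_0_iff [simp]: "poly4 f = 0 \<longleftrightarrow> f = 0"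
  by (cases f) (simp add: zero_prod_def)

lemma poly5_eq_0_iff [simp]: "poly5 k = 0 \<longleftrightarrow> k = 0"
  by (cases k) (simp add: zero_prod_def)

lemma poly_tuple_0 [simp]: "poly4 0 = 0" "poly7 0 = 0" "poly8 0 = 0"
  by (simp_all add: zero_prod_def)

lemma degree_poly3_le: "degree (poly3 g) \<le> 2"
  by (cases g) simp

lemma degree_poly4_le: "degree (poly4 f) \<le> 3"
  by (cases f) simp

lemma degree_poly5_le: "degree (poly5 k) \<le> 4"
  by (cases k) simp

lemma poly_sq_cube: "poly7 (sq_cube (f, g)) = (poly4 f)\<^sup>2 + poly3 g ^ 3"
  by (cases f; cases g) (simp add: power2_eq_square power3_eq_cube algebra_simps)

lemma poly_sq_cube_deriv:
  "poly7 (sq_cube_deriv (f, g) (a, b)) = 2 * poly4 f * poly4 a + 3 * (poly3 g)\<^sup>2 * poly3 b"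
  by (cases f; cases g; cases a; cases b)
     (simp add: power2_eq_square numeral_poly algebra_simps)

lemma poly_mult45: "poly8 (mult45 f k) = poly4 f * poly5 k"
  by (cases f; cases k) (simp add: algebra_simps)

lemma poly_wronskian:
  "poly8 (wronskian p g) = pderiv (poly7 p) * poly3 g - 3 * poly7 p * pderiv (poly3 g)"
  by (cases p; cases g) (simp add: numeral_poly pderiv_pCons algebra_simps)

text \<open>In P' G - 3 P G' the terms 3 G^3 G' cancel, and the rest has the factor F.\<close>

lemma mult45_cofactor: "mult45 f (cofactor f g) = wronskian (sq_cube (f, g)) g"
  by (cases f; cases g) (simp add: power2_eq_square power3_eq_cube algebra_simps)

lemma continuous_sq_cube: "continuous_on A sq_cube"
proof -
  \<comment> \<open>The pattern abstraction exposes the components as projections, to which the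
    continuity rules apply.\<close>
  have "continuous_on A (\<lambda>((f0, f1, f2, f3), (g0, g1, g2)). sq_cube ((f0, f1, f2, f3), (g0, g1, g2)))"
    unfolding sq_cube.simps split_beta by (intro continuous_intros)
  then show ?thesis by (simp add: split_beta del: sq_cube.simps)
qed

lemma sq_cube_has_derivative: "(sq_cube has_derivative sq_cube_deriv u) (at u)"
proof -
  obtain f0 f1 f2 f3 g0 g1 g2 where u: "u = ((f0, f1, f2, f3), (g0, g1, g2))" by (metis surj_pair)
  have "((\<lambda>((f0, f1, f2, f3), (g0, g1, g2)). sq_cube ((f0, f1, f2, f3), (g0, g1, g2))) has_derivative
     (\<lambda>((a0, a1, a2, a3), (b0, b1, b2)). sq_cube_deriv u ((a0, a1, a2, a3), (b0, b1, b2)))) (at u)"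
    unfolding u sq_cube.simps sq_cube_deriv.simps split_beta
    by (rule derivative_eq_intros refl | simp)+ (simp add: fun_eq_iff algebra_simps power2_eq_square)
  moreover have "(\<lambda>((f0, f1, f2, f3), (g0, g1, g2)). sq_cube ((f0, f1, f2, f3), (g0, g1, g2))) = sq_cube"
    "(\<lambda>((a0, a1, a2, a3), (b0, b1, b2)). sq_cube_deriv u ((a0, a1, a2, a3), (b0, b1, b2))) = sq_cube_deriv u"
    by (auto simp: fun_eq_iff simp del: sq_cube.simps sq_cube_deriv.simps)
  ultimately show ?thesis by simp
qed

lemma bounded_bilinear_mult45: "bounded_bilinear mult45"
  unfolding bilinear_conv_bounded_bilinear[symmetric] bilinear_def
  by (intro conjI allI linearI; clarsimp simp: algebra_simps scaleR_conv_of_real)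

lemma tendsto_wronskian:
  assumes "(p \<longlongrightarrow> p') F" "(g \<longlongrightarrow> g') F"
  shows "((\<lambda>n. wronskian (p n) (g n)) \<longlongrightarrow> wronskian p' g') F"
proof -
  have "((\<lambda>n. case (p n, g n) of ((p0, p1, p2, p3, p4, p5, p6), (g0, g1, g2)) \<Rightarrow>
      wronskian (p0, p1, p2, p3, p4, p5, p6) (g0, g1, g2)) \<longlongrightarrow>
      (case (p', g') of ((p0, p1, p2, p3, p4, p5, p6), (g0, g1, g2)) \<Rightarrow>
      wronskian (p0, p1, p2, p3, p4, p5, p6) (g0, g1, g2))) F"
    unfolding wronskian.simps split_beta by (intro tendsto_intros assms; simp add: assms)
  then show ?thesis by (simp add: split_beta del: wronskian.simps)
qed

text \<open>Forms are dehomogenised by \<open>y = 1\<close>; degree exactly 6 excludes a root at infinity.\<close>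

definition simple_sextic :: "c7 \<Rightarrow> bool" where
  "simple_sextic p \<longleftrightarrow> degree (poly7 p) = 6 \<and>
     (\<forall>z. poly (poly7 p) z = 0 \<longrightarrow> poly (pderiv (poly7 p)) z \<noteq> 0)"

section \<open>The image is open at simple sextics\<close>

text \<open>The differential is injective between spaces of equal dimension, hence surjective. Its
  right inverse at the single point \<open>u\<close>, with continuity, suffices for the open mapping
  theorem.\<close>

lemma simple_sextic_in_interior:
  assumes "simple_sextic (sq_cube u)"
  shows "sq_cube u \<in> interior (range sq_cube)"
proof -
  obtain f g where u: "u = (f, g)" by (cases u)
  have lin: "linear (sq_cube_deriv u)"
    using sq_cube_has_derivative by (rule has_derivative_linear)
  have "v = 0" if "sq_cube_deriv u v = 0" for v
  proof -
    obtain a b where v: "v = (a, b)" by (cases v)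
    have "2 * poly4 f * poly4 a + 3 * (poly3 g)\<^sup>2 * poly3 b = 0"
      using that poly_sq_cube_deriv[of f g a b] by (simp add: u v del: sq_cube_deriv.simps)
    then have "poly4 a = 0 \<and> poly3 b = 0"
      using assms unfolding u simple_sextic_def
      by (intro sq_plus_cube_tangent_injective[OF _ _ _ _ poly_sq_cube])
         (auto simp: degree_poly3_le degree_poly4_le)
    then show ?thesis by (simp add: v zero_prod_def)
  qed
  then have inj: "inj (sq_cube_deriv u)" using lin by (simp add: linear_injective_0)
  then have "dim (range (sq_cube_deriv u)) = DIM(c4 \<times> c3)"
    using lin by (simp add: dim_image_eq)
  then have "span (range (sq_cube_deriv u)) = UNIV"
    by (subst dim_eq_full[symmetric]) simp
  moreover have "span (range (sq_cube_deriv u)) = range (sq_cube_deriv u)"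
    unfolding span_eq_iff by (rule linear_subspace_image[OF lin subspace_UNIV])
  ultimately have "surj (sq_cube_deriv u)" by simp
  then obtain h where "linear h" "sq_cube_deriv u \<circ> h = id"
    using linear_surjective_right_inverse[OF lin] by blast
  then show ?thesis
    by (intro sussmann_open_mapping[OF open_UNIV continuous_sq_cube _ sq_cube_has_derivative])
       (auto simp: linear_conv_bounded_linear)
qed

section \<open>The image is closed among simple sextics\<close>

text \<open>The weights 3 and 2 make the square and the cube scale alike.\<close>

lemma sq_cube_scale: "sq_cube (s ^ 3 *\<^sub>R f, s\<^sup>2 *\<^sub>R g) = s ^ 6 *\<^sub>R sq_cube (f, g)"
proof -
  obtain f0 f1 f2 f3 g0 g1 g2 where fg: "f = (f0, f1, f2, f3)" "g = (g0, g1, g2)"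
    by (metis surj_pair)
  show ?thesis
    unfolding fg scaleR_Pair scaleR_conv_of_real sq_cube.simps prod.inject of_real_power
    by (intro conjI; simp add: eval_nat_numeral algebra_simps)
qed

lemma wronskian_scale: "wronskian p (s *\<^sub>R g) = s *\<^sub>R wronskian p g"
  by (cases p; cases g) (simp add: scaleR_conv_of_real algebra_simps)

text \<open>Only the pairs are rescaled in the wronskian identity, not the sextics, so
  \<open>p\<close> survives in the limit and \<open>degenerate_limit_double_root\<close> gives it a
  double root.\<close>

lemma simple_sextic_closure:
  assumes p: "simple_sextic p" and cl: "p \<in> closure (range sq_cube)"
  shows "p \<in> range sq_cube"
proof (rule ccontr)
  assume np: "p \<notin> range sq_cube"
  have "\<exists>u. norm u > real n \<and> dist (sq_cube u) p < inverse (real (Suc n))" for n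
  proof -
    \<comment> \<open>The image of the ball is compact and misses \<open>p\<close>, so
      \<open>V\<close> is a neighbourhood of \<open>p\<close> whose values have all their preimages
      outside the ball.\<close>
    define V where "V = - (sq_cube ` cball 0 (real n)) \<inter> ball p (inverse (real (Suc n)))"
    have "compact (sq_cube ` cball 0 (real n))"
      by (intro compact_continuous_image continuous_sq_cube compact_cball)
    then have "open V"
      unfolding V_def by (intro open_Int open_Compl compact_imp_closed open_ball)
    moreover have "p \<in> V"
      using np by (auto simp: V_def)
    ultimately have "V \<inter> range sq_cube \<noteq> {}"
      using cl open_Int_closure_eq_empty[of V "range sq_cube"] by blast
    then obtain u where "sq_cube u \<in> V" by blast
    then show ?thesis by (intro exI[of _ u]) (auto simp: V_def dist_commute image_iff)
  qed
  then obtain u where un: "\<And>n. norm (u n) > real n"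
    and ud: "\<And>n. dist (sq_cube (u n)) p < inverse (real (Suc n))"
    by metis
  have ulim: "(\<lambda>n. sq_cube (u n)) \<longlonglongrightarrow> p"
    by (rule metric_tendsto_imp_tendsto[OF LIMSEQ_inverse_real_of_nat])
       (use ud in \<open>auto intro!: always_eventually less_imp_le\<close>)
  define f g where "f = (\<lambda>n. fst (u n))" and "g = (\<lambda>n. snd (u n))"
  have u: "u n = (f n, g n)" for n by (simp add: f_def g_def)
  \<comment> \<open>\<open>N\<close> is homogeneous of degree 6 for the weights (3, 2), and scaling
    by \<open>s\<close> normalises it to 1, see \<open>ab1\<close>.\<close>
  define N where "N = (\<lambda>n. norm (f n) ^ 2 + norm (g n) ^ 3)"
  define s where "s = (\<lambda>n. root 6 (inverse (N n)))"
  \<comment> \<open>Each of x - 1 <= x^2 and x - 1 <= x^3 loses 1, which does not affect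
    divergence.\<close>
  have Nlb: "real n - 2 \<le> N n" for n
  proof -
    have sq: "x - 1 \<le> x ^ 2" for x :: real
      using zero_le_power2[of "x - 1 / 2"] by (simp add: power2_eq_square algebra_simps)
    have cube: "x - 1 \<le> x ^ 3" if "x \<ge> 0" for x :: real
    proof (cases "x \<le> 1")
      case True
      then have "x - 1 \<le> 0" by simp
      also have "0 \<le> x ^ 3" using that by simp
      finally show ?thesis .
    next
      case False
      then show ?thesis using self_le_power[of x 3] by simp
    qed
    have "real n \<le> norm (f n) + norm (g n)"
      using un[of n] norm_Pair_le[of "f n" "g n"] by (simp add: u)
    then show ?thesis using sq[of "norm (f n)"] cube[of "norm (g n)"] by (simp add: N_def)
  qed
  have Npos: "N n > 0" for n
  proof -
    have "u n \<noteq> 0" using un[of n] by auto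
    then have "f n \<noteq> 0 \<or> g n \<noteq> 0" by (auto simp: u zero_prod_def)
    then show ?thesis unfolding N_def by (auto intro: add_pos_nonneg add_nonneg_pos)
  qed
  have s: "s n > 0" "s n ^ 6 = inverse (N n)" for n
    using Npos[of n] by (simp_all add: s_def)
  have "filterlim (\<lambda>n. real n - 2) at_top sequentially" by real_asymp
  then have "filterlim N at_top sequentially"
    by (rule filterlim_at_top_mono) (simp add: Nlb)
  then have s0: "(\<lambda>n. s n ^ 6) \<longlonglongrightarrow> 0"
    unfolding s by (rule tendsto_inverse_0_at_top)
  define a b where "a = (\<lambda>n. s n ^ 3 *\<^sub>R f n)" and "b = (\<lambda>n. (s n)\<^sup>2 *\<^sub>R g n)"
  have ab1: "norm (a n) ^ 2 + norm (b n) ^ 3 = 1" for n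
  proof -
    have "norm (a n) ^ 2 + norm (b n) ^ 3 = s n ^ 6 * N n"
      by (simp add: a_def b_def N_def power_mult_distrib algebra_simps flip: power_mult)
    then show ?thesis using s(2)[of n] Npos[of n] by simp
  qed
  have "norm (a n) \<le> 1 \<and> norm (b n) \<le> 1" for n
  proof -
    have "0 \<le> norm (a n) ^ 2" by simp
    with ab1[of n] have "norm (b n) ^ 3 \<le> 1" by linarith
    moreover have "0 \<le> norm (b n) ^ 3" by simp
    with ab1[of n] have "norm (a n) ^ 2 \<le> 1" by linarith
    ultimately show ?thesis by (simp add: power_le_one_iff)
  qed
  then have "(a n, b n) \<in> cball 0 1 \<times> cball 0 1" for n by simp
  moreover have "compact (cball (0::c4) 1 \<times> cball (0::c3) 1)"
    by (intro compact_Times compact_cball)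
  ultimately obtain l r where r: "strict_mono (r :: nat \<Rightarrow> nat)" and l: "((\<lambda>n. (a n, b n)) \<circ> r) \<longlonglongrightarrow> l"
    unfolding compact_def by meson
  define A B where "A = fst l" and "B = snd l"
  have A: "(\<lambda>n. a (r n)) \<longlonglongrightarrow> A" and B: "(\<lambda>n. b (r n)) \<longlonglongrightarrow> B"
    using tendsto_fst[OF l] tendsto_snd[OF l] by (simp_all add: A_def B_def o_def)
  have "(\<lambda>n. norm (a (r n)) ^ 2 + norm (b (r n)) ^ 3) \<longlonglongrightarrow> norm A ^ 2 + norm B ^ 3"
    by (intro tendsto_intros A B)
  then have AB1: "norm A ^ 2 + norm B ^ 3 = 1"
    unfolding ab1 by (simp add: LIMSEQ_const_iff)
  have "(\<lambda>n. sq_cube (a (r n), b (r n))) \<longlonglongrightarrow> sq_cube (A, B)"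
    using continuous_on_tendsto_compose[OF continuous_sq_cube[of UNIV] tendsto_Pair[OF A B]] by simp
  moreover have "(\<lambda>n. sq_cube (a (r n), b (r n))) \<longlonglongrightarrow> 0"
  proof -
    have "(\<lambda>n. s n ^ 6 *\<^sub>R sq_cube (u n)) \<longlonglongrightarrow> 0 *\<^sub>R p"
      by (intro tendsto_scaleR s0 ulim)
    then have "(\<lambda>n. sq_cube (a n, b n)) \<longlonglongrightarrow> 0"
      by (simp add: a_def b_def sq_cube_scale u)
    from LIMSEQ_subseq_LIMSEQ[OF this r] show ?thesis by (simp add: o_def)
  qed
  ultimately have "sq_cube (A, B) = 0" by (rule LIMSEQ_unique)
  then have rel: "(poly4 A)\<^sup>2 + poly3 B ^ 3 = 0"
    using poly_sq_cube[of A B] by (simp del: poly7.simps)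
  have "A \<noteq> 0"
  proof
    assume "A = 0"
    with rel have "poly3 B = 0" by (simp del: poly3.simps)
    with \<open>A = 0\<close> AB1 show False by simp
  qed
  \<comment> \<open>The factor \<open>f\<close> absorbs \<open>s n ^ 3\<close> but the right side
    only \<open>(s n)\<^sup>2\<close>, which leaves \<open>inverse (s n)\<close>. These scaled
    cofactors have no evident bound, hence the use of
    \<open>bilinear_limit_in_range\<close>.\<close>
  have eqn: "mult45 (a n) (inverse (s n) *\<^sub>R cofactor (f n) (g n)) = wronskian (sq_cube (u n)) (b n)" for n
  proof -
    interpret bounded_bilinear mult45 by (rule bounded_bilinear_mult45)
    have "inverse (s n) * s n ^ 3 = (s n)\<^sup>2"
      using s(1)[of n] by (simp add: power2_eq_square power3_eq_cube)
    then show ?thesis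
      by (simp add: a_def b_def u scaleR_left scaleR_right mult45_cofactor wronskian_scale)
  qed
  have "(\<lambda>n. wronskian (sq_cube (u (r n))) (b (r n))) \<longlonglongrightarrow> wronskian p B"
    using LIMSEQ_subseq_LIMSEQ[OF ulim r] by (intro tendsto_wronskian B) (simp add: o_def)
  then have lim: "(\<lambda>n. mult45 (a (r n)) (inverse (s (r n)) *\<^sub>R cofactor (f (r n)) (g (r n)))) \<longlonglongrightarrow> wronskian p B"
    unfolding eqn .
  have "\<exists>k. mult45 A k = wronskian p B"
  proof (rule bilinear_limit_in_range[OF bounded_bilinear_mult45 _ A lim])
    fix k assume "mult45 A k = 0"
    then have "poly4 A * poly5 k = 0" using poly_mult45[of A k] by (simp del: poly8.simps mult45.simps)
    then show "k = 0" using \<open>A \<noteq> 0\<close> by simp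
  qed
  then obtain k where "mult45 A k = wronskian p B" ..
  then have eq: "poly4 A * poly5 k = pderiv (poly7 p) * poly3 B - 3 * poly7 p * pderiv (poly3 B)"
    using poly_mult45[of A k] poly_wronskian[of p B] by simp
  have "poly4 A \<noteq> 0 \<or> poly3 B \<noteq> 0" using \<open>A \<noteq> 0\<close> by simp
  moreover have "degree (poly7 p) = 6" using p by (simp add: simple_sextic_def)
  ultimately have "\<exists>z. poly (poly7 p) z = 0 \<and> poly (pderiv (poly7 p)) z = 0"
    using degenerate_limit_double_root[OF degree_poly4_le degree_poly3_le degree_poly5_le _ rel _ eq] by blast
  then show False using p unfolding simple_sextic_def by blast
qed

section \<open>Polynomial functions and the discriminant of a sextic\<close>

lemma polyfun_sum:
  assumes "\<And>a. a \<in> A \<Longrightarrow> F a \<in> polyfun n"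
  shows "(\<lambda>c. \<Sum>a\<in>A. F a c) \<in> polyfun n"
  using assms by (induction A rule: infinite_finite_induct) (auto intro: polyfun.intros)

lemma polyfun_prod:
  assumes "\<And>a. a \<in> A \<Longrightarrow> F a \<in> polyfun n"
  shows "(\<lambda>c. \<Prod>a\<in>A. F a c) \<in> polyfun n"
  using assms by (induction A rule: infinite_finite_induct) (auto intro: polyfun.intros)

text \<open>On a complex line, the zero locus of a polynomial function thus becomes the root set of
  a univariate polynomial.\<close>

lemma polyfun_line:
  assumes "F \<in> polyfun n"
  shows "\<exists>E. \<forall>t. poly E t = F (\<lambda>i. a i + t * b i)"
  using assms
proof induction
  case (const c)
  show ?case by (rule exI[of _ "[:c:]"]) simp
next
  case (var i)
  show ?case by (rule exI[of _ "[:a i, b i:]"]) simp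
next
  case (add p q)
  then obtain E E' where "\<forall>t. poly E t = p (\<lambda>i. a i + t * b i)" "\<forall>t. poly E' t = q (\<lambda>i. a i + t * b i)"
    by blast
  then show ?case by (intro exI[of _ "E + E'"]) simp
next
  case (mult p q)
  then obtain E E' where "\<forall>t. poly E t = p (\<lambda>i. a i + t * b i)" "\<forall>t. poly E' t = q (\<lambda>i. a i + t * b i)"
    by blast
  then show ?case by (intro exI[of _ "E * E'"]) simp
qed

text \<open>The coefficient of z^k in z^j times the quintic with coefficients
  \<open>h\<close>.\<close>

definition band_row :: "(nat \<Rightarrow> complex) \<Rightarrow> nat \<Rightarrow> nat \<Rightarrow> complex" where
  "band_row h j k = (if j \<le> k \<and> k \<le> j + 5 then h (k - j) else 0)"

lemma sum_band_row:
  assumes "j \<le> 4"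
  shows "(\<Sum>k<10. band_row h j k * z ^ k) = z ^ j * (\<Sum>i\<le>5. h i * z ^ i)"
proof -
  \<comment> \<open>The bound \<open>j \<le> 4\<close> keeps the whole band within the ten
    columns.\<close>
  have "(\<Sum>k<10. band_row h j k * z ^ k) = (\<Sum>k\<in>{j..j+5}. h (k - j) * z ^ k)"
    using assms by (intro sum.mono_neutral_cong_right) (auto simp: band_row_def)
  also have "\<dots> = (\<Sum>i\<le>5. z ^ j * (h i * z ^ i))"
    by (rule sum.reindex_bij_witness[of _ "\<lambda>i. i + j" "\<lambda>k. k - j"])
       (auto simp flip: power_add)
  finally show ?thesis by (simp add: sum_distrib_left)
qed

text \<open>Sylvester matrix of the partial derivatives \<open>\<partial>P/\<partial>y\<close> and \<open>\<partial>P/\<partial>x\<close> of the sextic form \<open>P\<close>.\<close>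

definition sylvester_entry :: "(nat \<Rightarrow> complex) \<Rightarrow> nat \<Rightarrow> nat \<Rightarrow> complex" where
  "sylvester_entry c j k =
    (if j < 5 then band_row (\<lambda>i. of_nat (6 - i) * c i) j k
     else band_row (\<lambda>i. of_nat (Suc i) * c (Suc i)) (j - 5) k)"

text \<open>This resultant is the discriminant of the form up to a nonzero constant.\<close>

definition sextic_disc :: "(nat \<Rightarrow> complex) \<Rightarrow> complex" where
  "sextic_disc c = det (mat 10 10 (\<lambda>(j, k). sylvester_entry c j k))"

text \<open>Leibniz expansion; each entry is zero or a multiple of one coefficient.\<close>

lemma sextic_disc_polyfun: "sextic_disc \<in> polyfun 7"
proof -
  have ent: "(\<lambda>c. sylvester_entry c j k) \<in> polyfun 7" for j k
    unfolding sylvester_entry_def band_row_def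
    by (cases "j < 5"; cases "j \<le> k \<and> k \<le> j + 5"; cases "j - 5 \<le> k \<and> k \<le> j - 5 + 5")
       (auto intro!: polyfun.intros)
  have "sextic_disc = (\<lambda>c. \<Sum>p\<in>{p. p permutes {0..<10}}.
      signof p * (\<Prod>i\<in>{0..<10}. sylvester_entry c i (p i)))"
    unfolding sextic_disc_def
    by (rule ext, subst det_def'[of _ 10])
       (auto intro!: sum.cong prod.cong dest: permutes_in_image)
  also have "\<dots> \<in> polyfun 7"
    by (intro polyfun_sum polyfun.mult polyfun_prod polyfun.const ent)
  finally show ?thesis .
qed

text \<open>Both partial derivatives vanish at \<open>(z, 1)\<close>, so the vector of powers of
  \<open>z\<close> lies in the kernel of the Sylvester matrix.\<close>

lemma sextic_disc_double_root:
  assumes "poly [:c 0, c 1, c 2, c 3, c 4, c 5, c 6:] z = 0"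
    and "poly (pderiv [:c 0, c 1, c 2, c 3, c 4, c 5, c 6:]) z = 0"
  shows "sextic_disc c = 0"
proof -
  have px: "c 1 + 2 * c 2 * z + 3 * c 3 * z^2 + 4 * c 4 * z^3 + 5 * c 5 * z^4 + 6 * c 6 * z^5 = 0"
    using assms(2) by (simp add: pderiv_pCons algebra_simps eval_nat_numeral)
  have p0: "c 0 + c 1 * z + c 2 * z^2 + c 3 * z^3 + c 4 * z^4 + c 5 * z^5 + c 6 * z^6 = 0"
    using assms(1) by (simp add: algebra_simps eval_nat_numeral)
  \<comment> \<open>Euler's identity 6 P = x P_x + y P_y at \<open>y = 1\<close>.\<close>
  have "6 * c 0 + 5 * c 1 * z + 4 * c 2 * z^2 + 3 * c 3 * z^3 + 2 * c 4 * z^4 + c 5 * z^5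
      = 6 * (c 0 + c 1 * z + c 2 * z^2 + c 3 * z^3 + c 4 * z^4 + c 5 * z^5 + c 6 * z^6)
        - z * (c 1 + 2 * c 2 * z + 3 * c 3 * z^2 + 4 * c 4 * z^3 + 5 * c 5 * z^4 + 6 * c 6 * z^5)"
    by (simp add: algebra_simps eval_nat_numeral)
  then have py: "6 * c 0 + 5 * c 1 * z + 4 * c 2 * z^2 + 3 * c 3 * z^3 + 2 * c 4 * z^4 + c 5 * z^5 = 0"
    by (simp only: px p0) simp
  define v where "v = vec 10 (\<lambda>k. z ^ k)"
  define M where "M = mat 10 10 (\<lambda>(j, k). sylvester_entry c j k)"
  have "(\<Sum>k<10. sylvester_entry c j k * z ^ k) = 0" if "j < 10" for j
  proof -
    have "(\<Sum>i\<le>5. of_nat (6 - i) * c i * z ^ i) = 0"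
      using py by (simp add: eval_nat_numeral)
    moreover have "(\<Sum>i\<le>5. of_nat (Suc i) * c (Suc i) * z ^ i) = 0"
      using px by (simp add: eval_nat_numeral)
    ultimately show ?thesis
      using that sum_band_row[of j _ z] sum_band_row[of "j - 5" _ z]
      by (cases "j < 5") (simp_all add: sylvester_entry_def del: of_nat_Suc)
  qed
  then have "M *\<^sub>v v = 0\<^sub>v 10"
    by (intro eq_vecI) (auto simp: M_def v_def scalar_prod_def lessThan_atLeast0)
  \<comment> \<open>The entry \<open>z ^ 0\<close> is 1 even for \<open>z = 0\<close>.\<close>
  moreover have "v $ 0 \<noteq> 0\<^sub>v 10 $ 0" by (simp add: v_def)
  then have "v \<noteq> 0\<^sub>v 10" by metis
  moreover have "v \<in> carrier_vec 10" "M \<in> carrier_mat 10 10" by (simp_all add: v_def M_def)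
  ultimately show ?thesis
    unfolding sextic_disc_def M_def[symmetric] using det_0_iff_vec_prod_zero_field by blast
qed

text \<open>The partial derivatives of x^6 + y^6 are 6 y^5 and 6 x^5, whose shifts fill exactly the
  diagonal.\<close>

lemma sextic_disc_fermat:
  assumes "c = (\<lambda>i. if i = 0 \<or> i = 6 then 1 else 0)"
  shows "sextic_disc c \<noteq> 0"
proof -
  have "sylvester_entry c j k = (if j = k then 6 else 0)" if "j < 10" "k < 10" for j k
    using that by (auto simp: sylvester_entry_def band_row_def assms)
  then have "mat 10 10 (\<lambda>(j, k). sylvester_entry c j k) = 6 \<cdot>\<^sub>m 1\<^sub>m 10"
    by (intro eq_matI) auto
  then show ?thesis by (simp add: sextic_disc_def)
qed

section \<open>Connectedness along a complex line\<close>

text \<open>Off the roots of \<open>E\<close>, the preimages of the interior of the image and of the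
  complement of its closure are disjoint open sets covering a connected set, and the first contains
  0.\<close>

lemma simple_sextic_connect:
  fixes L :: "complex \<Rightarrow> c7"
  assumes L: "continuous_on UNIV L" "L 0 \<in> range sq_cube"
    and E: "poly E 0 \<noteq> 0" "poly E 1 \<noteq> 0"
    and simple: "\<And>t. poly E t \<noteq> 0 \<Longrightarrow> simple_sextic (L t)"
  shows "L 1 \<in> range sq_cube"
proof -
  define T where "T = UNIV - {t. poly E t = 0}"
  have "E \<noteq> 0" using E by auto
  \<comment> \<open>Removing finitely many points does not disconnect the plane, whose real
    dimension is 2.\<close>
  then have "connected T"
    unfolding T_def by (intro connected_open_delete_finite) (auto simp: poly_roots_finite)
  have T: "simple_sextic (L t)" if "t \<in> T" for t
    using that simple by (simp add: T_def)
  define U V where "U = L -` interior (range sq_cube)" and "V = L -` (- closure (range sq_cube))"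
  have "open U" "open V"
    unfolding U_def V_def using L(1) by (auto intro!: open_vimage)
  moreover have TU: "t \<in> U" if t: "t \<in> T" "L t \<in> range sq_cube" for t
  proof -
    obtain u where "L t = sq_cube u" using t(2) by (rule imageE)
    with T[OF t(1)] simple_sextic_in_interior[of u] show ?thesis by (simp add: U_def)
  qed
  moreover have TV: "t \<in> V" if "t \<in> T" "L t \<notin> range sq_cube" for t
    using simple_sextic_closure[OF T[OF that(1)]] that(2) by (auto simp: V_def)
  ultimately have "open U" "open V" and "T \<subseteq> U \<union> V" by blast+
  moreover have "U \<inter> V \<inter> T = {}"
    using interior_subset[of "range sq_cube"] closure_subset[of "range sq_cube"]
    unfolding U_def V_def by blast
  moreover have "0 \<in> U \<inter> T" using TU[of 0] L(2) E(1) by (auto simp: T_def)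
  ultimately have "V \<inter> T = {}" using connectedD[OF \<open>connected T\<close>] by blast
  then show ?thesis using TV[of 1] E(2) by (auto simp: T_def)
qed

definition coeff_tuple :: "(nat \<Rightarrow> complex) \<Rightarrow> c7" where
  "coeff_tuple c = (c 0, c 1, c 2, c 3, c 4, c 5, c 6)"

text \<open>The discriminant excludes finite double roots; the factor \<open>c 6\<close> keeps the
  degree at 6.\<close>

lemma simple_sextic_coeff_tuple:
  assumes "sextic_disc c * c 6 \<noteq> 0"
  shows "simple_sextic (coeff_tuple c)"
proof -
  have "poly7 (coeff_tuple c) = [:c 0, c 1, c 2, c 3, c 4, c 5, c 6:]"
    by (simp add: coeff_tuple_def)
  moreover have "degree [:c 0, c 1, c 2, c 3, c 4, c 5, c 6:] = 6"
    using assms by simp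
  ultimately show ?thesis
    unfolding simple_sextic_def using sextic_disc_double_root[of c] assms by auto
qed

lemma sextic_disc_nonzero_in_range:
  assumes "sextic_disc p * p 6 \<noteq> 0"
  shows "coeff_tuple p \<in> range sq_cube"
proof -
  define q :: "nat \<Rightarrow> complex" where "q = (\<lambda>i. if i = 0 \<or> i = 6 then 1 else 0)"
  define l where "l = (\<lambda>t i. q i + t * (p i - q i))"
  have "(\<lambda>c. sextic_disc c * c 6) \<in> polyfun 7"
    by (intro polyfun.mult sextic_disc_polyfun polyfun.var) simp
  then obtain E where E: "\<And>t. poly E t = sextic_disc (l t) * l t 6"
    using polyfun_line[of _ 7 q "\<lambda>i. p i - q i"] unfolding l_def by blast
  have l01: "l 0 = q" "l 1 = p" by (simp_all add: l_def)
  have "coeff_tuple (l 1) \<in> range sq_cube"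
  proof (rule simple_sextic_connect)
    show "continuous_on UNIV (\<lambda>t. coeff_tuple (l t))"
      unfolding coeff_tuple_def l_def by (intro continuous_intros)
    \<comment> \<open>The base point x^6 + y^6, from the cubic x^3 and the quadratic y^2.\<close>
    have "sq_cube ((0, 0, 0, 1), (1, 0, 0)) = coeff_tuple (l 0)"
      by (simp add: l01 coeff_tuple_def q_def)
    then show "coeff_tuple (l 0) \<in> range sq_cube" by (metis rangeI)
    show "poly E 0 \<noteq> 0"
      using sextic_disc_fermat[OF q_def] by (simp add: E l01) (simp add: q_def)
    show "poly E 1 \<noteq> 0" using assms by (simp add: E l01)
    show "simple_sextic (coeff_tuple (l t))" if "poly E t \<noteq> 0" for t
      using that by (intro simple_sextic_coeff_tuple) (simp add: E)
  qed
  then show ?thesis by (simp add: l01)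
qed

section \<open>Return to binary forms\<close>

lemma sq_cube_bform:
  assumes "coeff_tuple p \<in> range sq_cube"
  shows "\<exists>f\<in>hom_forms 3. \<exists>g\<in>hom_forms 2.
    \<forall>x y. bform 6 p x y = (bform 3 f x y)^2 + (bform 2 g x y)^3"
proof -
  obtain f0 f1 f2 f3 g0 g1 g2 where "coeff_tuple p = sq_cube ((f0, f1, f2, f3), (g0, g1, g2))"
    using assms by (metis imageE surj_pair)
  then have p: "p 0 = f0\<^sup>2 + g0 ^ 3"
    "p 1 = 2 * f0 * f1 + 3 * g0\<^sup>2 * g1"
    "p 2 = f1\<^sup>2 + 2 * f0 * f2 + 3 * g0\<^sup>2 * g2 + 3 * g0 * g1\<^sup>2"
    "p 3 = 2 * f0 * f3 + 2 * f1 * f2 + g1 ^ 3 + 6 * g0 * g1 * g2"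
    "p 4 = f2\<^sup>2 + 2 * f1 * f3 + 3 * g0 * g2\<^sup>2 + 3 * g1\<^sup>2 * g2"
    "p 5 = 2 * f2 * f3 + 3 * g1 * g2\<^sup>2"
    "p 6 = f3\<^sup>2 + g2 ^ 3"
    by (simp_all add: coeff_tuple_def)
  define f where "f = (\<lambda>_::nat. 0)(0 := f0, 1 := f1, 2 := f2, 3 := f3)"
  define g where "g = (\<lambda>_::nat. 0)(0 := g0, 1 := g1, 2 := g2)"
  have s: "{..6} = {0, 1, 2, 3, 4, 5, 6::nat}" "{..3} = {0, 1, 2, 3::nat}" "{..2} = {0, 1, 2::nat}"
    by auto
  have "bform 6 p x y = (bform 3 f x y)^2 + (bform 2 g x y)^3" for x y
  proof -
    have "bform 6 p x y = p 0 * y^6 + p 1 * x * y^5 + p 2 * x^2 * y^4 + p 3 * x^3 * y^3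
        + p 4 * x^4 * y^2 + p 5 * x^5 * y + p 6 * x^6"
      by (simp add: bform_def s)
    moreover have "bform 3 f x y = f0 * y^3 + f1 * x * y^2 + f2 * x^2 * y + f3 * x^3"
      by (simp add: bform_def s f_def)
    moreover have "bform 2 g x y = g0 * y^2 + g1 * x * y + g2 * x^2"
      by (simp add: bform_def s g_def)
    ultimately show ?thesis
      by (simp only: p) (simp add: eval_nat_numeral algebra_simps)
  qed
  moreover have "f \<in> hom_forms 3" "g \<in> hom_forms 2"
    by (auto simp: hom_forms_def f_def g_def)
  ultimately show ?thesis by blast
qed

theorem theorem1p5:
  shows "general 6 (\<lambda>p. \<exists>f\<in>hom_forms 3. \<exists>g\<in>hom_forms 2.
           \<forall>x y. bform 6 p x y = (bform 3 f x y)^2 + (bform 2 g x y)^3)"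
proof -
  \<comment> \<open>The complement of one hypersurface; it contains x^6 + y^6.\<close>
  define U where "U = hom_forms 6 - {c. \<forall>q\<in>{\<lambda>c. sextic_disc c * c 6}. q c = 0}"
  have "(\<lambda>c. sextic_disc c * c 6) \<in> polyfun (Suc 6)"
    using polyfun.mult[OF sextic_disc_polyfun polyfun.var[of 6 7]] by simp
  then have "zariski_open_in 6 U"
    unfolding zariski_open_in_def U_def by (intro exI[of _ "{\<lambda>c. sextic_disc c * c 6}"]) simp
  moreover have "(\<lambda>i. if i = 0 \<or> i = 6 then 1 else 0) \<in> U"
    using sextic_disc_fermat[OF refl] by (simp add: U_def hom_forms_def)
  moreover have "\<exists>f\<in>hom_forms 3. \<exists>g\<in>hom_forms 2.
      \<forall>x y. bform 6 p x y = (bform 3 f x y)^2 + (bform 2 g x y)^3" if "p \<in> U" for p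
    using that by (intro sq_cube_bform sextic_disc_nonzero_in_range) (simp add: U_def)
  ultimately show ?thesis unfolding general_def by blast
qed

end
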